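(* The CEGIS refinement algorithm described below, instantiated with C$^-$ as background theory and equipped with the stopping condition below, is complete: it terminates for every specification $\sigma$ (returning a program $P$ satisfying $\sigma$ on all inputs if one exists, and the verdict "unsatisfiable" otherwise).
   Context: C$^-$ is the fragment of C in which all loops have constant bounds, recursion is limited to constant depth, and all arrays are statically allocated with constant size (nondeterministic values, assumptions and arbitrary-width types are allowed); safety of C$^-$ programs is decidable by a single bounded model checking query. Specifications $\sigma(x,P)$ are expressed in C$^-$, with inputs $x$ consisting of $n$ bits and $P$ a finite loop-free list of instructions in SSA form. CEGIS maintains a finite set of test inputs, initially empty, and loops: (SYNTH) find a program $P$, searching programs in order of increasing length, with $\sigma(i,P)$ for all current test inputs $i$; (VERIF) decide $\exists x . \lnot\sigma(x,P)$; if unsatisfiable return $P$, else add the counterexample $x$ to the test inputs and repeat. Stopping condition: if the length of candidate programs searched would need to be increased beyond $2^n$ instructions, the algorithm terminates with the verdict "unsatisfiable".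
   Formalization: Specifications may use P only by running it on n bits, not by inspecting its text (σ = "P has more than 2^n instructions" refutes the literal claim); C⁻ is a core language without primitive floats, structs, unions or type punning, which loses no such specification. *)

theory Defs
  imports "HOL-Library.Word" "HOL-Library.Signed_Division" "HOL-Library.Monad_Syntax"
begin

section \<open>Candidate programs: loop-free instruction lists in SSA form\<close>

text \<open>
  A program reads \<open>n\<close> input bits and computes on machine words of an arbitrary fixed
  width \<open>LENGTH('w)\<close>. The \<open>j\<close>-th instruction defines the \<open>j\<close>-th SSA value, and its operands
  are input bits, constants, or values defined by strictly earlier instructions. The program's
  output is the value of its last instruction. All instructions are total; division by zero
  follows the conventions of the word library.
\<close>

datatype 'c operand = Input nat | Constant 'c | Result nat

datatype unary = NEG | NOT

datatype binary =
    ADD | SUB | MUL | DIV | MOD | UMIN | UMAX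
  | AND | OR | XOR | SHL | LSHR | ASHR
  | LE | LT | SLE | SLT | EQ | NEQ | IMPLIES

datatype 'o instr = Unary unary 'o | Binary binary 'o 'o | Ite 'o 'o 'o

type_synonym 'w program = "'w word operand instr list"

fun operand_ok :: "nat \<Rightarrow> nat \<Rightarrow> 'c operand \<Rightarrow> bool" where
  "operand_ok n j (Input i) \<longleftrightarrow> i < n"
| "operand_ok n j (Constant c) \<longleftrightarrow> True"
| "operand_ok n j (Result i) \<longleftrightarrow> i < j"

definition programs :: "nat \<Rightarrow> 'w::len program set" where
  "programs n = {P. P \<noteq> [] \<and> (\<forall>j < length P. \<forall>a \<in> set_instr (P ! j). operand_ok n j a)}"

fun unary_sem :: "unary \<Rightarrow> 'w::len word \<Rightarrow> 'w word" where
  "unary_sem NEG a = - a"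
| "unary_sem NOT a = not a"

fun binary_sem :: "binary \<Rightarrow> 'w::len word \<Rightarrow> 'w word \<Rightarrow> 'w word" where
  "binary_sem ADD a b = a + b"
| "binary_sem SUB a b = a - b"
| "binary_sem MUL a b = a * b"
| "binary_sem DIV a b = a div b"
| "binary_sem MOD a b = a mod b"
| "binary_sem UMIN a b = min a b"
| "binary_sem UMAX a b = max a b"
| "binary_sem AND a b = and a b"
| "binary_sem OR a b = or a b"
| "binary_sem XOR a b = xor a b"
| "binary_sem SHL a b = push_bit (unat b) a"
| "binary_sem LSHR a b = drop_bit (unat b) a"
| "binary_sem ASHR a b = signed_drop_bit (unat b) a"
| "binary_sem LE a b = of_bool (a \<le> b)"
| "binary_sem LT a b = of_bool (a < b)"
| "binary_sem SLE a b = of_bool (sint a \<le> sint b)"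
| "binary_sem SLT a b = of_bool (sint a < sint b)"
| "binary_sem EQ a b = of_bool (a = b)"
| "binary_sem NEQ a b = of_bool (a \<noteq> b)"
| "binary_sem IMPLIES a b = of_bool (a \<noteq> 0 \<longrightarrow> b \<noteq> 0)"

fun operand_val :: "bool list \<Rightarrow> 'w::len word list \<Rightarrow> 'w word operand \<Rightarrow> 'w word" where
  "operand_val x rs (Input i) = of_bool (x ! i)"
| "operand_val x rs (Constant c) = c"
| "operand_val x rs (Result j) = rs ! j"

fun instr_val :: "bool list \<Rightarrow> 'w::len word list \<Rightarrow> 'w word operand instr \<Rightarrow> 'w word" where
  "instr_val x rs (Unary f a) = unary_sem f (operand_val x rs a)"
| "instr_val x rs (Binary f a b) = binary_sem f (operand_val x rs a) (operand_val x rs b)"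
| "instr_val x rs (Ite a b c) =
     (if operand_val x rs a \<noteq> 0 then operand_val x rs b else operand_val x rs c)"

definition outval :: "'w::len program \<Rightarrow> bool list \<Rightarrow> 'w word" where
  "outval P x = last (foldl (\<lambda>rs i. rs @ [instr_val x rs i]) [] P)"


section \<open>The language C\<open>\<^sup>-\<close>\<close>

subsection \<open>Syntax\<close>

text \<open>Bit-vector types of arbitrary width, and pointers.\<close>

datatype ctype = Unsigned nat | Signed nat | Ptr

type_synonym vname = string
type_synonym fname = string

datatype c_unop = Minus1 | BitNot | LogNot

datatype c_binop =
    Plus | Minus | Times | Divide | Modulo | BitAnd | BitOr | BitXor | ShiftL | ShiftR
  | Less | LessEq | Equal | NotEqual

text \<open>
  The type carried by an operator is the one in which it is computed, that is, the result of
  C's usual arithmetic conversions made explicit. The short-circuit operators are instances of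
  \<open>Cond\<close>; pointer arithmetic \<open>p + i\<close> is \<open>AddrOf (Index (Deref p) i)\<close>.
\<close>

datatype expr =
    Lit ctype int
  | Read lval
  | AddrOf lval
  | UnOp ctype c_unop expr
  | BinOp ctype c_binop expr expr
  | Cond expr expr expr
  | Cast ctype expr
  | PtrEq expr expr
  | PtrDiff expr expr
and lval =
    Var vname
  | Index lval expr
  | Deref expr

text \<open>
  \<open>Loop N e t s\<close> is \<open>for (k = 0; k < N && e; k++, t) s\<close> with a constant \<open>N\<close> and a fresh counter
  \<open>k\<close>. \<open>Nondet\<close> stores an arbitrary value of the target's type. \<open>CallP l es\<close> applies the unknown
  program \<open>P\<close> to the bits \<open>es\<close> and stores its output in \<open>l\<close>.
\<close>

datatype stmt =
    Skip
  | Assign lval expr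
  | Nondet lval
  | Assume expr
  | Assert expr
  | Seq stmt stmt
  | If expr stmt stmt
  | Loop nat expr stmt stmt
  | Break
  | Continue
  | Return "expr option"
  | Call "lval option" fname "expr list"
  | CallP lval "expr list"

text \<open>
  Every variable is declared with a constant number of elements (1 for a scalar).
\<close>

record fundef =
  params :: "(vname \<times> ctype) list"
  locals :: "(vname \<times> ctype \<times> nat) list"
  result_type :: "ctype option"
  body :: stmt

text \<open>
  \<open>call_depth\<close> is the constant bound on the nesting depth of function calls (the call of
  \<open>entry\<close> included), hence on the recursion depth.
\<close>

record cminus =
  globals :: "(vname \<times> ctype \<times> nat) list"
  fundefs :: "(fname \<times> fundef) list"
  call_depth :: nat
  entry :: fname

subsection \<open>Values and memory\<close>

text \<open>
  Memory is a list of blocks, one per declared variable; a pointer is a block number with an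
  offset. Blocks are never reused, and the blocks of a function activation are emptied when it
  returns, so that accesses through dangling pointers are out of bounds.
\<close>

datatype val = Undef | IntV int | Null | PtrV nat int

type_synonym mem = "(ctype \<times> val list) list"
type_synonym env = "vname \<rightharpoonup> nat"

fun convert :: "ctype \<Rightarrow> val \<Rightarrow> val option" where
  "convert (Unsigned w) (IntV i) = Some (IntV (take_bit w i))"
| "convert (Signed w) (IntV i) = Some (IntV (signed_take_bit (w - 1) i))"
| "convert Ptr (IntV i) = (if i = 0 then Some Null else None)"
| "convert Ptr Null = Some Null"
| "convert Ptr (PtrV b i) = Some (PtrV b i)"
| "convert _ _ = None"

fun values_of :: "ctype \<Rightarrow> val list option" where
  "values_of (Unsigned w) = Some (map IntV [0 .. 2 ^ w - 1])"
| "values_of (Signed w) = Some (map IntV [- (2 ^ (w - 1)) .. 2 ^ (w - 1) - 1])"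
| "values_of Ptr = None"

fun width :: "ctype \<Rightarrow> nat" where
  "width (Unsigned w) = w"
| "width (Signed w) = w"
| "width Ptr = 0"

fun int_of :: "val \<Rightarrow> int option" where
  "int_of (IntV i) = Some i"
| "int_of _ = None"

fun truth :: "val \<Rightarrow> bool option" where
  "truth Undef = None"
| "truth (IntV i) = Some (i \<noteq> 0)"
| "truth Null = Some False"
| "truth (PtrV _ _) = Some True"

definition in_bounds :: "mem \<Rightarrow> nat \<times> int \<Rightarrow> bool" where
  "in_bounds m a \<longleftrightarrow>
     fst a < length m \<and> 0 \<le> snd a \<and> snd a < int (length (snd (m ! fst a)))"

definition load :: "mem \<Rightarrow> nat \<times> int \<Rightarrow> val option" where
  "load m a =
     (if in_bounds m a \<and> snd (m ! fst a) ! nat (snd a) \<noteq> Undef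
      then Some (snd (m ! fst a) ! nat (snd a)) else None)"

definition store :: "mem \<Rightarrow> nat \<times> int \<Rightarrow> val \<Rightarrow> mem option" where
  "store m a v =
     (if in_bounds m a
      then map_option
             (\<lambda>u. m[fst a := (fst (m ! fst a), (snd (m ! fst a))[nat (snd a) := u])])
             (convert (fst (m ! fst a)) v)
      else None)"

subsection \<open>Expressions\<close>

text \<open>
  Arithmetic is bit-precise and wraps around. \<open>None\<close> stands for an error: division by zero, an
  invalid shift amount, an out-of-bounds or dangling access, reading an uninitialised location,
  or an ill-typed operation.
\<close>

fun unop_sem :: "ctype \<Rightarrow> c_unop \<Rightarrow> int \<Rightarrow> val option" where
  "unop_sem t Minus1 a = convert t (IntV (- a))"
| "unop_sem t BitNot a = convert t (IntV (not a))"
| "unop_sem t LogNot a = Some (IntV (of_bool (a = 0)))"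

fun binop_sem :: "ctype \<Rightarrow> c_binop \<Rightarrow> int \<Rightarrow> int \<Rightarrow> val option" where
  "binop_sem t Plus a b = convert t (IntV (a + b))"
| "binop_sem t Minus a b = convert t (IntV (a - b))"
| "binop_sem t Times a b = convert t (IntV (a * b))"
| "binop_sem t Divide a b = (if b = 0 then None else convert t (IntV (a sdiv b)))"
| "binop_sem t Modulo a b = (if b = 0 then None else convert t (IntV (a smod b)))"
| "binop_sem t BitAnd a b = convert t (IntV (and a b))"
| "binop_sem t BitOr a b = convert t (IntV (or a b))"
| "binop_sem t BitXor a b = convert t (IntV (xor a b))"
| "binop_sem t ShiftL a b =
     (if 0 \<le> b \<and> b < int (width t) then convert t (IntV (push_bit (nat b) a)) else None)"
| "binop_sem t ShiftR a b =
     (if 0 \<le> b \<and> b < int (width t) then convert t (IntV (drop_bit (nat b) a)) else None)"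
| "binop_sem t Less a b = Some (IntV (of_bool (a < b)))"
| "binop_sem t LessEq a b = Some (IntV (of_bool (a \<le> b)))"
| "binop_sem t Equal a b = Some (IntV (of_bool (a = b)))"
| "binop_sem t NotEqual a b = Some (IntV (of_bool (a \<noteq> b)))"

definition int_as :: "ctype \<Rightarrow> val \<Rightarrow> int option" where
  "int_as t v = Option.bind (convert t v) int_of"

fun ptr_diff :: "val \<Rightarrow> val \<Rightarrow> val option" where
  "ptr_diff (PtrV b i) (PtrV c j) = (if b = c then Some (IntV (i - j)) else None)"
| "ptr_diff _ _ = None"

fun eval :: "mem \<Rightarrow> env \<Rightarrow> expr \<Rightarrow> val option"
  and addr :: "mem \<Rightarrow> env \<Rightarrow> lval \<Rightarrow> (nat \<times> int) option"
where
  "eval m \<rho> (Lit t i) = convert t (IntV i)"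
| "eval m \<rho> (Read l) = do { a \<leftarrow> addr m \<rho> l; load m a }"
| "eval m \<rho> (AddrOf l) = do { a \<leftarrow> addr m \<rho> l; Some (PtrV (fst a) (snd a)) }"
| "eval m \<rho> (UnOp t f e) = do { v \<leftarrow> eval m \<rho> e; i \<leftarrow> int_as t v; unop_sem t f i }"
| "eval m \<rho> (BinOp t f e e') =
     do { v \<leftarrow> eval m \<rho> e; v' \<leftarrow> eval m \<rho> e';
          i \<leftarrow> int_as t v;
          j \<leftarrow> (if f \<in> {ShiftL, ShiftR} then int_of v' else int_as t v');
          binop_sem t f i j }"
| "eval m \<rho> (Cond e e1 e2) =
     do { v \<leftarrow> eval m \<rho> e; c \<leftarrow> truth v; if c then eval m \<rho> e1 else eval m \<rho> e2 }"
| "eval m \<rho> (Cast t e) = do { v \<leftarrow> eval m \<rho> e; convert t v }"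
| "eval m \<rho> (PtrEq e e') =
     do { v \<leftarrow> eval m \<rho> e; v' \<leftarrow> eval m \<rho> e';
          p \<leftarrow> convert Ptr v; q \<leftarrow> convert Ptr v';
          Some (IntV (of_bool (p = q))) }"
| "eval m \<rho> (PtrDiff e e') =
     do { v \<leftarrow> eval m \<rho> e; v' \<leftarrow> eval m \<rho> e'; ptr_diff v v' }"
| "addr m \<rho> (Var x) = map_option (\<lambda>b. (b, 0)) (\<rho> x)"
| "addr m \<rho> (Index l e) =
     do { a \<leftarrow> addr m \<rho> l; v \<leftarrow> eval m \<rho> e; i \<leftarrow> int_of v; Some (fst a, snd a + i) }"
| "addr m \<rho> (Deref e) =
     do { v \<leftarrow> eval m \<rho> e; case v of PtrV b i \<Rightarrow> Some (b, i) | _ \<Rightarrow> None }"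

fun collect :: "'a option list \<Rightarrow> 'a list option" where
  "collect [] = Some []"
| "collect (v # vs) = do { a \<leftarrow> v; as \<leftarrow> collect vs; Some (a # as) }"

subsection \<open>Statements and function calls\<close>

text \<open>
  An execution yields the finite list of the outcomes of all its nondeterministic paths, where
  \<open>None\<close> is a path with a safety violation (a failed assertion or an error) and paths that fail
  an assumption have no outcome. Constant loop bounds, call depth and widths make this a total
  recursive function, and it is in this sense that safety is decidable.
\<close>

datatype flow = Normal | Broke | Continued | Returned "val option"

type_synonym 'a outcomes = "'a option list"

definition guarded :: "'b option \<Rightarrow> ('b \<Rightarrow> 'a outcomes) \<Rightarrow> 'a outcomes" where
  "guarded r f = (case r of None \<Rightarrow> [None] | Some b \<Rightarrow> f b)"

definition andthen :: "'b outcomes \<Rightarrow> ('b \<Rightarrow> 'a outcomes) \<Rightarrow> 'a outcomes" where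
  "andthen rs f = concat (map (\<lambda>r. guarded r f) rs)"

primrec iterate :: "nat \<Rightarrow> (mem \<Rightarrow> bool option) \<Rightarrow> (mem \<Rightarrow> (flow \<times> mem) outcomes)
    \<Rightarrow> (mem \<Rightarrow> (flow \<times> mem) outcomes) \<Rightarrow> mem \<Rightarrow> (flow \<times> mem) outcomes"
where
  "iterate 0 g t s m = [Some (Normal, m)]"
| "iterate (Suc k) g t s m =
     guarded (g m) (\<lambda>c.
       if \<not> c then [Some (Normal, m)]
       else andthen (s m) (\<lambda>(fl, m').
         case fl of
           Broke \<Rightarrow> [Some (Normal, m')]
         | Returned v \<Rightarrow> [Some (Returned v, m')]
         | _ \<Rightarrow> andthen (t m') (\<lambda>(fl', m'').
             if fl' = Normal then iterate k g t s m'' else [None])))"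

text \<open>
  The first two arguments of \<open>exec\<close> interpret calls of declared functions and of the unknown
  program. An argument of \<open>CallP\<close> is converted to one bit, that is, reduced modulo 2.
\<close>

fun exec ::
  "(fname \<Rightarrow> val list \<Rightarrow> mem \<Rightarrow> (val option \<times> mem) outcomes)
   \<Rightarrow> (bool list \<Rightarrow> int option) \<Rightarrow> env \<Rightarrow> stmt \<Rightarrow> mem \<Rightarrow> (flow \<times> mem) outcomes"
where
  "exec F p \<rho> Skip m = [Some (Normal, m)]"
| "exec F p \<rho> (Assign l e) m =
     guarded (do { v \<leftarrow> eval m \<rho> e; a \<leftarrow> addr m \<rho> l; store m a v })
       (\<lambda>m'. [Some (Normal, m')])"
| "exec F p \<rho> (Nondet l) m =
     guarded (do { a \<leftarrow> addr m \<rho> l;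
                   vs \<leftarrow> (if in_bounds m a then values_of (fst (m ! fst a)) else None);
                   Some (a, vs) })
       (\<lambda>(a, vs). map (\<lambda>v. map_option (Pair Normal) (store m a v)) vs)"
| "exec F p \<rho> (Assume e) m =
     guarded (do { v \<leftarrow> eval m \<rho> e; truth v })
       (\<lambda>c. if c then [Some (Normal, m)] else [])"
| "exec F p \<rho> (Assert e) m =
     guarded (do { v \<leftarrow> eval m \<rho> e; truth v })
       (\<lambda>c. if c then [Some (Normal, m)] else [None])"
| "exec F p \<rho> (Seq s1 s2) m =
     andthen (exec F p \<rho> s1 m) (\<lambda>(fl, m').
       if fl = Normal then exec F p \<rho> s2 m' else [Some (fl, m')])"
| "exec F p \<rho> (If e s1 s2) m =
     guarded (do { v \<leftarrow> eval m \<rho> e; truth v })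
       (\<lambda>c. if c then exec F p \<rho> s1 m else exec F p \<rho> s2 m)"
| "exec F p \<rho> (Loop N e t s) m =
     iterate N (\<lambda>m'. do { v \<leftarrow> eval m' \<rho> e; truth v })
       (\<lambda>m'. exec F p \<rho> t m') (\<lambda>m'. exec F p \<rho> s m') m"
| "exec F p \<rho> Break m = [Some (Broke, m)]"
| "exec F p \<rho> Continue m = [Some (Continued, m)]"
| "exec F p \<rho> (Return None) m = [Some (Returned None, m)]"
| "exec F p \<rho> (Return (Some e)) m =
     guarded (eval m \<rho> e) (\<lambda>v. [Some (Returned (Some v), m)])"
| "exec F p \<rho> (Call None f es) m =
     guarded (collect (map (eval m \<rho>) es)) (\<lambda>vs.
       andthen (F f vs m) (\<lambda>(_, m'). [Some (Normal, m')]))"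
| "exec F p \<rho> (Call (Some l) f es) m =
     guarded (collect (map (eval m \<rho>) es)) (\<lambda>vs.
       andthen (F f vs m) (\<lambda>(r, m').
         guarded (do { v \<leftarrow> r; a \<leftarrow> addr m' \<rho> l; store m' a v })
           (\<lambda>m''. [Some (Normal, m'')])))"
| "exec F p \<rho> (CallP l es) m =
     guarded (do { vs \<leftarrow> collect (map (eval m \<rho>) es);
                   is \<leftarrow> collect (map int_of vs);
                   r \<leftarrow> p (map odd is);
                   a \<leftarrow> addr m \<rho> l; store m a (IntV r) })
       (\<lambda>m'. [Some (Normal, m')])"

definition release :: "nat \<Rightarrow> mem \<Rightarrow> mem" where
  "release k m = take k m @ map (\<lambda>(t, _). (t, [])) (drop k m)"

fun result_of :: "ctype option \<Rightarrow> flow \<Rightarrow> val option option" where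
  "result_of (Some t) (Returned (Some v)) = map_option Some (convert t v)"
| "result_of None (Returned None) = Some None"
| "result_of None Normal = Some None"
| "result_of _ _ = None"

text \<open>
  The \<open>nat\<close> argument is the remaining call depth. A call beyond the depth bound is a violation
  (an unwinding assertion), so the bound never cuts off behaviour silently.
\<close>

primrec call :: "(fname \<times> fundef) list \<Rightarrow> (bool list \<Rightarrow> int option) \<Rightarrow> env \<Rightarrow> nat
    \<Rightarrow> fname \<Rightarrow> val list \<Rightarrow> mem \<Rightarrow> (val option \<times> mem) outcomes"
where
  "call fs p \<rho> 0 = (\<lambda>f vs m. [None])"
| "call fs p \<rho> (Suc d) = (\<lambda>f vs m.
     guarded
       (do { fd \<leftarrow> map_of fs f;
             us \<leftarrow> (if length vs = length (params fd)
                    then collect (map2 convert (map snd (params fd)) vs) else None);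
             Some (fd, us) })
       (\<lambda>(fd, us).
         let frame = map2 (\<lambda>(_, t) u. (t, [u])) (params fd) us
                       @ map (\<lambda>(_, t, k). (t, replicate k Undef)) (locals fd);
             names = map fst (params fd) @ map fst (locals fd);
             \<rho>' = \<rho> ++ map_of (zip names [length m ..< length m + length names])
         in andthen (exec (call fs p \<rho> d) p \<rho>' (body fd) (m @ frame)) (\<lambda>(fl, m').
              guarded (result_of (result_type fd) fl) (\<lambda>r.
                [Some (r, release (length m) m')]))))"

text \<open>Global variables are zero-initialised, as prescribed by C for static storage.\<close>

definition initial_mem :: "cminus \<Rightarrow> mem" where
  "initial_mem S =
     map (\<lambda>(_, t, k). (t, replicate k (if t = Ptr then Null else IntV 0))) (globals S)"

definition global_env :: "cminus \<Rightarrow> env" where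
  "global_env S = map_of (zip (map fst (globals S)) [0 ..< length (globals S)])"

definition run :: "cminus \<Rightarrow> (bool list \<Rightarrow> int option) \<Rightarrow> val list \<Rightarrow> (val option \<times> mem) outcomes"
where
  "run S p vs =
     call (fundefs S) p (global_env S) (call_depth S) (entry S) vs (initial_mem S)"

subsection \<open>Specifications\<close>

text \<open>
  A specification is a C\<open>\<^sup>-\<close> program whose entry function receives the \<open>n\<close> bits of \<open>x\<close> as
  arguments and may call the candidate \<open>P\<close>, as often as it likes, on any \<open>n\<close> bits.
  \<open>\<sigma>(x,P)\<close> means that \<open>assert(entry(x))\<close> is safe: no path has a violation, and every path that
  satisfies the assumptions returns a nonzero value.
\<close>

definition sat :: "nat \<Rightarrow> cminus \<Rightarrow> bool list \<Rightarrow> 'w::len program \<Rightarrow> bool" where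
  "sat n S x P \<longleftrightarrow>
     (\<forall>r \<in> set (run S (\<lambda>y. if length y = n then Some (uint (outval P y)) else None)
                      (map (\<lambda>b. IntV (of_bool b)) x)).
        case r of Some (Some v, _) \<Rightarrow> truth v = Some True | _ \<Rightarrow> False)"


section \<open>CEGIS refinement\<close>

text \<open>
  \<open>SYNTH T k\<close>: searching a candidate of length \<open>k\<close> for the test inputs \<open>T\<close>.
  \<open>VERIF T P\<close>: checking the candidate \<open>P\<close>. Which consistent candidate and which
  counterexample are found is left nondeterministic. Candidates have at least one instruction,
  so each search starts at length 1.
\<close>

datatype 'p cegis_state =
    SYNTH "bool list set" nat
  | VERIF "bool list set" 'p
  | RETURN 'p
  | UNSATISFIABLE

definition consistent ::
  "nat \<Rightarrow> (bool list \<Rightarrow> 'w::len program \<Rightarrow> bool) \<Rightarrow> bool list set \<Rightarrow> nat \<Rightarrow> 'w program set"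
where
  "consistent n \<sigma> T k = {P \<in> programs n. length P = k \<and> (\<forall>i \<in> T. \<sigma> i P)}"

inductive cegis_step ::
  "nat \<Rightarrow> (bool list \<Rightarrow> 'w::len program \<Rightarrow> bool)
   \<Rightarrow> 'w program cegis_state \<Rightarrow> 'w program cegis_state \<Rightarrow> bool"
  for n \<sigma>
where
  candidate: "P \<in> consistent n \<sigma> T k \<Longrightarrow> cegis_step n \<sigma> (SYNTH T k) (VERIF T P)"
| longer: "consistent n \<sigma> T k = {} \<Longrightarrow> k + 1 \<le> 2 ^ n \<Longrightarrow>
     cegis_step n \<sigma> (SYNTH T k) (SYNTH T (k + 1))"
| give_up: "consistent n \<sigma> T k = {} \<Longrightarrow> k + 1 > 2 ^ n \<Longrightarrow>
     cegis_step n \<sigma> (SYNTH T k) UNSATISFIABLE"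
| counterexample: "length x = n \<Longrightarrow> \<not> \<sigma> x P \<Longrightarrow>
     cegis_step n \<sigma> (VERIF T P) (SYNTH (insert x T) 1)"
| verified: "\<forall>x. length x = n \<longrightarrow> \<sigma> x P \<Longrightarrow> cegis_step n \<sigma> (VERIF T P) (RETURN P)"

definition cegis_init :: "'w::len program cegis_state" where
  "cegis_init = SYNTH {} 1"

definition solves :: "nat \<Rightarrow> (bool list \<Rightarrow> 'w::len program \<Rightarrow> bool) \<Rightarrow> 'w program \<Rightarrow> bool" where
  "solves n \<sigma> P \<longleftrightarrow> P \<in> programs n \<and> (\<forall>x. length x = n \<longrightarrow> \<sigma> x P)"

text \<open>Each candidate search ranges over a finite set.\<close>

lemma finite_programs_of_length: "finite {P \<in> programs n. length P = k}"
proof -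
  define A :: "'a word operand set" where
    "A = Input ` {..<n} \<union> range Constant \<union> Result ` {..<k}"
  have fin_A: "finite A"
    by (simp add: A_def)
  have fin_un: "finite (UNIV :: unary set)"
  proof -
    have "(UNIV :: unary set) \<subseteq> {NEG, NOT}"
      using unary.exhaust by blast
    then show ?thesis by (rule finite_subset) simp
  qed
  have fin_bin: "finite (UNIV :: binary set)"
  proof -
    have "(UNIV :: binary set) \<subseteq> {ADD, SUB, MUL, DIV, MOD, UMIN, UMAX, AND, OR, XOR, SHL, LSHR,
      ASHR, LE, LT, SLE, SLT, EQ, NEQ, IMPLIES}"
    proof
      fix f :: binary
      show "f \<in> {ADD, SUB, MUL, DIV, MOD, UMIN, UMAX, AND, OR, XOR, SHL, LSHR,
        ASHR, LE, LT, SLE, SLT, EQ, NEQ, IMPLIES}"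
        by (cases f) simp_all
    qed
    then show ?thesis by (rule finite_subset) simp
  qed
  define I where "I = (\<lambda>(f, a). Unary f a) ` (UNIV \<times> A)
    \<union> (\<lambda>(f, a, b). Binary f a b) ` (UNIV \<times> A \<times> A)
    \<union> (\<lambda>(a, b, c). Ite a b c) ` (A \<times> A \<times> A)"
  have fin_I: "finite I"
    using fin_A fin_un fin_bin by (simp add: I_def finite_cartesian_product)
  have in_I: "i \<in> I" if "set_instr i \<subseteq> A" for i
    using that by (cases i) (force simp: I_def)+
  have in_A: "a \<in> A" if "operand_ok n j a" "j < k" for a j
    using that by (cases a) (auto simp: A_def)
  have "set P \<subseteq> I" if P: "P \<in> programs n" "length P = k" for P
  proof
    fix i assume "i \<in> set P"
    then obtain j where j: "j < length P" "i = P ! j"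
      by (auto simp: in_set_conv_nth)
    have "set_instr i \<subseteq> A"
      using P j in_A[of j] by (auto simp: programs_def)
    then show "i \<in> I" by (rule in_I)
  qed
  then have "{P \<in> programs n. length P = k} \<subseteq> {P. set P \<subseteq> I \<and> length P = k}"
    by blast
  then show ?thesis
    using finite_lists_length_eq[OF fin_I] by (rule finite_subset)
qed

end

theory Submission
  imports Defs
begin

text \<open>
  A specification sees a candidate only through the function it computes on \<open>n\<close> bits. Every such
  function is computed by a binary decision tree with constants at the leaves, that is, by at
  most \<open>2 ^ n - 1\<close> \<open>Ite\<close> instructions and one instruction that outputs the value of the root. So a
  solvable specification has a solution of length at most \<open>2 ^ n\<close>, which is consistent with every
  set of test inputs and prevents the algorithm from giving up. Termination holds because each
  counterexample is a new one of the \<open>2 ^ n\<close> inputs.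
\<close>

section \<open>Short programs for arbitrary functions\<close>

abbreviation results ::
  "bool list \<Rightarrow> 'w::len word list \<Rightarrow> 'w program \<Rightarrow> 'w word list" where
  "results x rs P \<equiv> foldl (\<lambda>rs i. rs @ [instr_val x rs i]) rs P"

lemma length_results [simp]: "length (results x rs P) = length rs + length P"
  by (induction P arbitrary: rs) simp_all

lemma results_extends: "\<exists>ys. results x rs P = rs @ ys"
proof (induction P arbitrary: rs)
  case (Cons i P)
  from Cons[of "rs @ [instr_val x rs i]"] show ?case by auto
qed simp

text \<open>Execution only appends values, so an operand that is legal after \<open>rs\<close>
  cannot see what \<open>P\<close> adds.\<close>

lemma operand_val_results:
  "operand_ok n (length rs) a \<Longrightarrow> operand_val x (results x rs P) a = operand_val x rs a"
  using results_extends[of x rs P] by (cases a) (auto simp: nth_append)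

lemma operand_ok_mono: "operand_ok n j a \<Longrightarrow> j \<le> k \<Longrightarrow> operand_ok n k a"
  by (cases a) auto

text \<open>\<open>k\<close> counts the values defined before \<open>L\<close> runs, so that
  fragments can be checked separately and then concatenated.\<close>

definition ssa_from :: "nat \<Rightarrow> nat \<Rightarrow> 'c operand instr list \<Rightarrow> bool" where
  "ssa_from n k L \<longleftrightarrow> (\<forall>j < length L. \<forall>a \<in> set_instr (L ! j). operand_ok n (k + j) a)"

lemma programs_iff_ssa_from: "P \<in> programs n \<longleftrightarrow> P \<noteq> [] \<and> ssa_from n 0 P"
  by (simp add: programs_def ssa_from_def)

lemma ssa_from_append:
  assumes "ssa_from n k L" and "ssa_from n (k + length L) M"
  shows "ssa_from n k (L @ M)"
  unfolding ssa_from_def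
proof (intro allI impI)
  fix j assume j: "j < length (L @ M)"
  show "\<forall>a \<in> set_instr ((L @ M) ! j). operand_ok n (k + j) a"
  proof (cases "j < length L")
    case True
    then show ?thesis using assms(1) by (simp add: ssa_from_def nth_append)
  next
    case False
    then obtain i where "j = length L + i" by (metis le_Suc_ex not_less)
    then show ?thesis using assms(2) j by (simp add: ssa_from_def nth_append add.assoc)
  qed
qed

text \<open>A leaf is a mere operand and costs no instruction; one \<open>Ite\<close> joins two
  trees over \<open>m\<close> bits, and \<open>2 * (2 ^ m - 1) + 1 = 2 ^ Suc m - 1\<close>. The
  induction varies \<open>k\<close> and \<open>f\<close> because the second subtree runs after the
  first and computes another restriction of the function.\<close>

lemma decision_tree:
  fixes f :: "bool list \<Rightarrow> 'w::len word"
  assumes "m \<le> n"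
  shows "\<exists>(L :: 'w program) a. length L < 2 ^ m \<and> ssa_from n k L \<and> operand_ok n (k + length L) a \<and>
    (\<forall>x rs. length x = n \<longrightarrow> length rs = k \<longrightarrow> operand_val x (results x rs L) a = f (take m x))"
  using assms
proof (induction m arbitrary: f k)
  case 0
  show ?case
    by (intro exI[of _ "[]"] exI[of _ "Constant (f [])"]) (simp add: ssa_from_def)
next
  case (Suc m)
  obtain L0 :: "'w program" and a0 where L0: "length L0 < 2 ^ m" "ssa_from n k L0"
    "operand_ok n (k + length L0) a0"
    "\<And>x rs. length x = n \<Longrightarrow> length rs = k \<Longrightarrow>
      operand_val x (results x rs L0) a0 = f (take m x @ [False])"
    using Suc.IH[OF Suc_leD[OF Suc.prems], of k "\<lambda>y. f (y @ [False])"] by blast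
  obtain L1 :: "'w program" and a1 where L1: "length L1 < 2 ^ m"
    "ssa_from n (k + length L0) L1" "operand_ok n (k + length L0 + length L1) a1"
    "\<And>x rs. length x = n \<Longrightarrow> length rs = k + length L0 \<Longrightarrow>
      operand_val x (results x rs L1) a1 = f (take m x @ [True])"
    using Suc.IH[OF Suc_leD[OF Suc.prems], of "k + length L0" "\<lambda>y. f (y @ [True])"]
    by blast
  \<comment> \<open>The root tests bit \<open>m\<close>. Its value comes after the \<open>k\<close>
    old ones and those of both subtrees, which fixes the index in \<open>a\<close>.\<close>
  define L where "L = L0 @ L1 @ [Ite (Input m) a1 a0]"
  define a :: "'w word operand" where "a = Result (k + length L0 + length L1)"
  have ite: "ssa_from n (k + length L0 + length L1) [Ite (Input m) a1 a0]"
    using Suc.prems L1(3) operand_ok_mono[OF L0(3), of "k + length L0 + length L1"]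
    by (simp add: ssa_from_def)
  have "ssa_from n k L"
    unfolding L_def by (intro ssa_from_append L0(2) L1(2) ite)
  moreover have "length L < 2 ^ Suc m"
    using L0(1) L1(1) by (simp add: L_def)
  moreover have "operand_ok n (k + length L) a"
    by (simp add: a_def L_def)
  moreover have "operand_val x (results x rs L) a = f (take (Suc m) x)"
    if len: "length x = n" "length rs = k" for x rs
  proof -
    let ?r0 = "results x rs L0"
    let ?r1 = "results x ?r0 L1"
    \<comment> \<open>\<open>a0\<close> refers only to values that exist before \<open>L1\<close>
      runs.\<close>
    have a0: "operand_val x ?r1 a0 = f (take m x @ [False])"
      using operand_val_results[of n ?r0 a0 x L1] L0 len by simp
    have a1: "operand_val x ?r1 a1 = f (take m x @ [True])"
      using L1(4) len by simp
    have "operand_val x (results x rs L) a = instr_val x ?r1 (Ite (Input m) a1 a0)"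
      using len by (simp add: L_def a_def nth_append)
    also have "\<dots> = f (take m x @ [x ! m])"
      using a0 a1 by (cases "x ! m") simp_all
    also have "\<dots> = f (take (Suc m) x)"
      using Suc.prems len by (simp add: take_Suc_conv_app_nth)
    finally show ?thesis .
  qed
  ultimately show ?case by blast
qed

lemma short_program:
  fixes f :: "bool list \<Rightarrow> 'w::len word"
  obtains P :: "'w program" where "P \<in> programs n" "length P \<le> 2 ^ n"
    "\<And>x. length x = n \<Longrightarrow> outval P x = f x"
proof -
  obtain L :: "'w program" and a where L: "length L < 2 ^ n" "ssa_from n 0 L"
    "operand_ok n (length L) a"
    "\<And>x. length x = n \<Longrightarrow> operand_val x (results x [] L) a = f x"
    using decision_tree[OF order_refl, of n 0 f] by fastforce
  \<comment> \<open>The output is the value of the last instruction, but \<open>a\<close> may be a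
    constant and \<open>L\<close> empty. Adding 0 outputs \<open>a\<close>, and the strict bound on
    \<open>length L\<close> leaves room for it.\<close>
  let ?P = "L @ [Binary ADD a (Constant 0)]"
  have "ssa_from n 0 ?P"
    using L(2,3) by (intro ssa_from_append) (simp_all add: ssa_from_def)
  then have "?P \<in> programs n"
    by (simp add: programs_iff_ssa_from)
  moreover have "length ?P \<le> 2 ^ n"
    using L(1) by simp
  moreover have "outval ?P x = f x" if "length x = n" for x
    using L(4)[OF that] by (simp add: outval_def)
  ultimately show thesis by (rule that)
qed

text \<open>\<open>P\<close> enters the specification only as an oracle on inputs of length
  \<open>n\<close>, and both oracles are the same function.\<close>

lemma sat_cong:
  assumes "\<And>y. length y = n \<Longrightarrow> outval P y = outval Q y"
  shows "sat n S x P \<longleftrightarrow> sat n S x Q"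
proof -
  have "(\<lambda>y. if length y = n then Some (uint (outval P y)) else None) =
        (\<lambda>y. if length y = n then Some (uint (outval Q y)) else None)"
    using assms by auto
  then show ?thesis by (simp only: sat_def)
qed

lemma short_solution:
  fixes P :: "'w::len program"
  assumes "solves n (sat n S) P"
  obtains Q :: "'w program" where "solves n (sat n S) Q" "length Q \<le> 2 ^ n"
proof -
  obtain Q :: "'w program" where Q: "Q \<in> programs n" "length Q \<le> 2 ^ n"
    "\<And>x. length x = n \<Longrightarrow> outval Q x = outval P x"
    using short_program[of n "outval P"] by blast
  have "solves n (sat n S) Q"
    using assms Q(1) sat_cong[OF Q(3)] by (simp add: solves_def)
  then show thesis using Q(2) by (rule that)
qed

section \<open>Correctness of the refinement loop\<close>

context
  fixes n :: nat and \<sigma> :: "bool list \<Rightarrow> 'w::len program \<Rightarrow> bool"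
begin

text \<open>The lower bound on \<open>length P\<close> records the failed searches; consistency
  under \<open>VERIF\<close> makes every counterexample new. For arbitrary \<open>\<sigma>\<close>,
  giving up excludes only solutions of length at most \<open>2 ^ n\<close>.\<close>

fun cegis_inv :: "'w program cegis_state \<Rightarrow> bool" where
  "cegis_inv (SYNTH T k) \<longleftrightarrow> T \<subseteq> {x. length x = n} \<and> k \<le> 2 ^ n \<and>
     (\<forall>P. solves n \<sigma> P \<longrightarrow> k \<le> length P)"
| "cegis_inv (VERIF T P) \<longleftrightarrow> T \<subseteq> {x. length x = n} \<and> P \<in> programs n \<and> (\<forall>x \<in> T. \<sigma> x P)"
| "cegis_inv (RETURN P) \<longleftrightarrow> solves n \<sigma> P"
| "cegis_inv UNSATISFIABLE \<longleftrightarrow> (\<forall>P. solves n \<sigma> P \<longrightarrow> 2 ^ n < length P)"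

lemma solves_length_pos: "solves n \<sigma> P \<Longrightarrow> 1 \<le> length P"
  by (cases P) (auto simp: solves_def programs_def)

lemma solves_consistent:
  "solves n \<sigma> P \<Longrightarrow> T \<subseteq> {x. length x = n} \<Longrightarrow> P \<in> consistent n \<sigma> T (length P)"
  by (auto simp: solves_def consistent_def)

lemma cegis_inv_init: "cegis_inv cegis_init"
  using solves_length_pos by (simp add: cegis_init_def)

lemma cegis_inv_step:
  assumes "cegis_step n \<sigma> s t" and "cegis_inv s"
  shows "cegis_inv t"
proof -
  \<comment> \<open>A solution of length \<open>k\<close> would pass all tests in \<open>T\<close>
    and so be a consistent candidate.\<close>
  have exceeds: "k + 1 \<le> length P"
    if "consistent n \<sigma> T k = {}" "cegis_inv (SYNTH T k)" "solves n \<sigma> P" for T k P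
  proof -
    have "length P \<noteq> k"
      using that solves_consistent[of P T] by auto
    then show ?thesis using that(2,3) by fastforce
  qed
  show ?thesis
    using assms
  proof cases
    case (candidate P T k)
    then show ?thesis using assms(2) by (simp add: consistent_def)
  next
    case (longer T k)
    then show ?thesis using assms(2) exceeds[of T k] by simp
  next
    case (give_up T k)
    then show ?thesis using assms(2) exceeds[of T k] by (auto intro: less_le_trans)
  next
    \<comment> \<open>The search restarts at length 1, a lower bound because programs are
      nonempty.\<close>
    case (counterexample x P T)
    then show ?thesis using assms(2) solves_length_pos by simp
  next
    case (verified P T)
    then show ?thesis using assms(2) by (simp add: solves_def)
  qed
qed

lemma cegis_inv_reachable: "(cegis_step n \<sigma>)\<^sup>*\<^sup>* cegis_init s \<Longrightarrow> cegis_inv s"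
  by (induction rule: rtranclp_induct) (auto intro: cegis_inv_init cegis_inv_step)

text \<open>Lexicographic in the number of untested inputs and the number of lengths left to search.\<close>

fun cegis_measure :: "'w program cegis_state \<Rightarrow> nat" where
  "cegis_measure (SYNTH T k) = card ({x. length x = n} - T) * (2 ^ n + 2) + (2 ^ n - k) + 2"
| "cegis_measure (VERIF T P) = card ({x. length x = n} - T) * (2 ^ n + 2) + 1"
| "cegis_measure _ = 0"

text \<open>A restart at length 1 sets the second component to \<open>2 ^ n + 1\<close>, less than
  the weight \<open>2 ^ n + 2\<close> of the input that is used up.\<close>

lemma cegis_measure_step:
  assumes "cegis_step n \<sigma> s t" and "cegis_inv s"
  shows "cegis_measure t < cegis_measure s"
  using assms
proof cases
  case (counterexample x P T)
  let ?U = "{x :: bool list. length x = n}"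
  have "finite ?U"
    using finite_lists_length_eq[of "UNIV :: bool set" n] by simp
  \<comment> \<open>\<open>P\<close> passes every test in \<open>T\<close> but fails on
    \<open>x\<close>.\<close>
  moreover have "x \<in> ?U - T"
    using counterexample assms(2) by auto
  moreover have "?U - insert x T = (?U - T) - {x}"
    by blast
  ultimately have "card (?U - T) = Suc (card (?U - insert x T))"
    using card_Suc_Diff1[of "?U - T" x] by simp
  then show ?thesis using counterexample by simp
qed (simp only: cegis_measure.simps; linarith)+

lemma cegis_terminates:
  "\<not> (\<exists>r. r 0 = cegis_init \<and> (\<forall>i. cegis_step n \<sigma> (r i) (r (Suc i))))"
proof
  assume "\<exists>r. r 0 = cegis_init \<and> (\<forall>i. cegis_step n \<sigma> (r i) (r (Suc i)))"
  then obtain r where r: "r 0 = cegis_init" "\<And>i. cegis_step n \<sigma> (r i) (r (Suc i))"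
    by blast
  have inv: "cegis_inv (r i)" for i
  proof (induction i)
    case 0
    show ?case unfolding r(1) by (rule cegis_inv_init)
  next
    case (Suc i)
    with r(2) show ?case by (rule cegis_inv_step)
  qed
  have "(r (Suc i), r i) \<in> measure cegis_measure" for i
    using cegis_measure_step[OF r(2) inv] by (simp only: in_measure)
  then have "\<exists>r. \<forall>i. (r (Suc i), r i) \<in> measure cegis_measure"
    by (intro exI[of _ r] allI)
  then show False
    using wf_measure[of cegis_measure] wf_iff_no_infinite_down_chain by blast
qed

text \<open>The guards of the rules leaving \<open>SYNTH\<close>, and of those leaving
  \<open>VERIF\<close>, exhaust all cases.\<close>

lemma cegis_stuck:
  assumes "\<nexists>t. cegis_step n \<sigma> s t"
  shows "(\<exists>P. s = RETURN P) \<or> s = UNSATISFIABLE"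
proof (cases s)
  case (SYNTH T k)
  have "\<exists>t. cegis_step n \<sigma> (SYNTH T k) t"
  proof (cases "consistent n \<sigma> T k = {}")
    case True
    show ?thesis
    proof (cases "k + 1 \<le> 2 ^ n")
      case le: True
      show ?thesis by (rule exI, rule longer[OF True le])
    next
      case False
      then have "k + 1 > 2 ^ n" by simp
      then show ?thesis by (intro exI, rule give_up[OF True])
    qed
  next
    case False
    then obtain P where "P \<in> consistent n \<sigma> T k" by blast
    then show ?thesis by (intro exI, rule candidate)
  qed
  then show ?thesis using assms SYNTH by simp
next
  case (VERIF T P)
  have "\<exists>t. cegis_step n \<sigma> (VERIF T P) t"
  proof (cases "\<forall>x. length x = n \<longrightarrow> \<sigma> x P")
    case True
    then show ?thesis by (intro exI, rule verified)
  next
    case False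
    then obtain x where "length x = n" "\<not> \<sigma> x P" by blast
    then show ?thesis by (intro exI, rule counterexample)
  qed
  then show ?thesis using assms VERIF by simp
qed simp_all

end

theorem theorem8:
  fixes n :: nat and S :: cminus
  shows "\<not> (\<exists>r :: nat \<Rightarrow> 'w::len program cegis_state.
            r 0 = cegis_init \<and> (\<forall>i. cegis_step n (sat n S) (r i) (r (Suc i))))
    \<and> (\<forall>s :: 'w program cegis_state.
         (cegis_step n (sat n S))\<^sup>*\<^sup>* cegis_init s \<and> \<not> (\<exists>t. cegis_step n (sat n S) s t) \<longrightarrow>
         (if \<exists>P :: 'w program. solves n (sat n S) P
          then \<exists>P. s = RETURN P \<and> solves n (sat n S) P
          else s = UNSATISFIABLE))"
proof (intro conjI allI impI)
  show "\<not> (\<exists>r :: nat \<Rightarrow> 'w program cegis_state.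
            r 0 = cegis_init \<and> (\<forall>i. cegis_step n (sat n S) (r i) (r (Suc i))))"
    by (rule cegis_terminates)
next
  fix s :: "'w program cegis_state"
  assume s: "(cegis_step n (sat n S))\<^sup>*\<^sup>* cegis_init s \<and> \<not> (\<exists>t. cegis_step n (sat n S) s t)"
  then have inv: "cegis_inv n (sat n S) s"
    by (simp add: cegis_inv_reachable)
  consider P where "s = RETURN P" | "s = UNSATISFIABLE"
    using s cegis_stuck by blast
  then show "if \<exists>P :: 'w program. solves n (sat n S) P
          then \<exists>P. s = RETURN P \<and> solves n (sat n S) P
          else s = UNSATISFIABLE"
  proof cases
    case 1
    then show ?thesis using inv by auto
  next
    case 2
    \<comment> \<open>The invariant excludes only solutions of length at most \<open>2 ^ n\<close>;
      a longer one would yield a short one computing the same function.\<close>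
    have "\<not> solves n (sat n S) P" for P :: "'w program"
    proof
      assume "solves n (sat n S) P"
      then obtain Q :: "'w program" where "solves n (sat n S) Q" "length Q \<le> 2 ^ n"
        by (rule short_solution)
      then show False using inv 2 by auto
    qed
    then show ?thesis using 2 by simp
  qed
qed

end
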